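(* Consider a price-coupling game $\mathcal{E}_1$ (price-anticipative formulation) in which the functions $g_i$, $i\in\mathcal{N}$, admit a potential function $\pi:X\to\mathbb{R}$. (1) The game admits an equilibrium if the function $(x,p)\mapsto h(p,x)+\pi(x)$ is continuous and the set $\mathcal{F}^1$ is nonempty and compact. (2) The set $\mathcal{F}^1$ is compact if the set $X$ is compact, the function $f$ is continuous, and the set-valued function $\mathcal{M}$ is continuous and uniformly bounded.
   Context: Setting: $\mathcal{N}=\{1,\dots,N\}$ is the set of players; $X_i\subseteq\mathbb{R}^{m_i}$ is the decision set of player $i$; $X=\prod_{i\in\mathcal{N}}X_i$; $x=(x_1,\dots,x_N)\in X$; $x^{-i}=(x_1,\dots,x_{i-1},x_{i+1},\dots,x_N)\in X^{-i}=\prod_{j\ne i}X_j$; one writes $x=(x_i,x^{-i})$. Prices $p$ lie in a Euclidean space $\mathbb{R}^k$. $h:\mathbb{R}^k\times X\to\mathbb{R}$ (written $h(p,x)$) is common to all players, and $g_i:X\to\mathbb{R}$ is specific to player $i$. Price-determining player: for $x\in X$, $\mathcal{S}(x)$ is the problem of minimizing $f(x,p)$ over $p\in\mathcal{M}(x)$, where $f:X\times\mathbb{R}^k\to\mathbb{R}$ and $\mathcal{M}$ is a set-valued map assigning to each $x\in X$ a set $\mathcal{M}(x)\subseteq\mathbb{R}^k$. $\mathrm{SOL}[\mathcal{S}(x)]$ is the set of minimizers of $\mathcal{S}(x)$. Game $\mathcal{E}_1$: given $x^{-i}$, player $i$ maximizes $h(p_i,x)+g_i(x)$ over $(x_i,p_i)\in\Omega_i(x^{-i})=\{(x_i,p_i)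 : x_i\in X_i,\ p_i\in\mathrm{SOL}[\mathcal{S}(x)]\}$, where $x=(x_i,x^{-i})$. Let $\mathcal{F}^1=\{(x,p) : x_i\in X_i\ \forall i\in\mathcal{N},\ p\in\mathrm{SOL}[\mathcal{S}(x)]\}$. A point $(x^*,p^* )\in\mathcal{F}^1$ is an equilibrium of $\mathcal{E}_1$ if for all $i\in\mathcal{N}$, $h(p^*,x^* )+g_i(x^* )\ge h(p_i,x_i,x^{-i*})+g_i(x_i,x^{-i*})$ for all $(x_i,p_i)\in\Omega_i(x^{-i*})$. The functions $g_i$, $i\in\mathcal{N}$, admit a potential function $\pi:X\to\mathbb{R}$ if for all $i\in\mathcal{N}$, all $x^{-i}\in X^{-i}$ and all $\tilde{x}_i,\hat{x}_i\in X_i$: $g_i(\tilde{x}_i,x^{-i})-g_i(\hat{x}_i,x^{-i})=\pi(\tilde{x}_i,x^{-i})-\pi(\hat{x}_i,x^{-i})$. Set-valued map conventions (Hogan): $\mathcal{M}$ is continuous if it is open and closed at every $x\in X$; closed at $x$ means: $x_n\to x$ in $X$, $p_n\in\mathcal{M}(x_n)$, $p_n\to p$ imply $p\in\mathcal{M}(x)$; open at $x$ means: for $x_n\to x$ in $X$ and $p\in\mathcal{M}(x)$ there are an index $m$ and a sequence $p_n\to p$ with $p_n\in\mathcal{M}(x_n)$ for all $n\ge m$. $\mathcal{M}$ is uniformly bounded if $\bigcup_{x\in X}\mathcal{M}(x)$ is bounded. *)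

theory Defs
  imports "HOL-Analysis.Analysis"
begin

text \<open>
  The players are \<open>{1..N}\<close>. Since the dimensions \<open>m i\<close> differ from player to player, the space
  of decisions of player \<open>i\<close> is represented by the library's \<^const>\<open>Euclidean_space\<close> \<open>(m i)\<close>, whose points are the sequences
  \<open>nat \<Rightarrow> real\<close> that vanish from index \<open>m i\<close> on, and profiles are \<open>undefined\<close> outside the player set.
  The type-class topology of \<open>nat \<Rightarrow> nat \<Rightarrow> real\<close> (that of pointwise convergence) restricts on
  profiles to the product of the Euclidean topologies, see \<open>profile_topology\<close> below.
\<close>

type_synonym strategy = "nat \<Rightarrow> real"
type_synonym profile = "nat \<Rightarrow> strategy"

definition decision_sets :: "nat \<Rightarrow> (nat \<Rightarrow> nat) \<Rightarrow> (nat \<Rightarrow> strategy set) \<Rightarrow> bool" where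
  "decision_sets N m X \<longleftrightarrow> (\<forall>i\<in>{1..N}. X i \<subseteq> topspace (Euclidean_space (m i)))"

definition profiles :: "nat \<Rightarrow> (nat \<Rightarrow> strategy set) \<Rightarrow> profile set" where
  "profiles N X = (\<Pi>\<^sub>E i\<in>{1..N}. X i)"

definition rival_profiles :: "nat \<Rightarrow> (nat \<Rightarrow> strategy set) \<Rightarrow> nat \<Rightarrow> profile set" where
  "rival_profiles N X i = (\<Pi>\<^sub>E j\<in>{1..N} - {i}. X j)"

definition rivals :: "nat \<Rightarrow> nat \<Rightarrow> profile \<Rightarrow> profile" where
  "rivals N i x = restrict x ({1..N} - {i})"

text \<open>The profile written \<open>(x\<^sub>i, x\<^sup>-\<^sup>i)\<close> is \<open>y(i := xi)\<close> for \<open>y \<in> rival_profiles N X i\<close>.\<close>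

lemma join_in_profiles:
  assumes "i \<in> {1..N}" "y \<in> rival_profiles N X i" "xi \<in> X i"
  shows "y(i := xi) \<in> profiles N X"
  using assms by (auto simp: profiles_def rival_profiles_def PiE_iff extensional_def)

lemma join_rivals:
  assumes "i \<in> {1..N}" "x \<in> profiles N X"
  shows "(rivals N i x)(i := x i) = x"
  using assms by (auto simp: profiles_def rivals_def PiE_iff extensional_def fun_eq_iff)

lemma rivals_in_rival_profiles:
  "x \<in> profiles N X \<Longrightarrow> rivals N i x \<in> rival_profiles N X i"
  by (auto simp: profiles_def rival_profiles_def rivals_def)

lemma profile_topology:
  assumes "decision_sets N m X"
  shows "subtopology (product_topology (\<lambda>i. Euclidean_space (m i)) {1..N}) (profiles N X)
       = top_of_set (profiles N X)" (is "?A = ?B")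
proof -
  let ?E = "\<lambda>i. Euclidean_space (m i)"
  have tE: "Euclidean_space n = top_of_set (topspace (Euclidean_space n))" for n
    unfolding Euclidean_space_def by (simp add: euclidean_product_topology)
  have top: "profiles N X \<subseteq> topspace (product_topology ?E {1..N})"
    using assms unfolding profiles_def decision_sets_def topspace_product_topology
    by (intro PiE_mono) auto
  have tA: "topspace ?A = profiles N X" using top by (simp add: Int_absorb1)
  have prj: "continuous_map ?A euclidean (\<lambda>x. x i)" for i
  proof (cases "i \<in> {1..N}")
    case True
    have "continuous_map (product_topology ?E {1..N}) (?E i) (\<lambda>x. x i)"
      using True by (rule continuous_map_product_projection)
    then have "continuous_map ?A (?E i) (\<lambda>x. x i)"
      by (rule continuous_map_from_subtopology)
    then show ?thesis
      by (subst (asm) (2) tE) (simp add: continuous_map_in_subtopology)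
  next
    case False
    have "continuous_map ?A euclidean (\<lambda>x. undefined)" by simp
    then show ?thesis
      by (rule continuous_map_eq) (use False tA in \<open>auto simp: profiles_def PiE_iff extensional_def\<close>)
  qed
  have "continuous_map ?A euclidean (\<lambda>x. x)"
    by (subst euclidean_product_topology[symmetric], subst continuous_map_componentwise_UNIV)
      (rule allI, rule prj)
  then have AB: "continuous_map ?A ?B (\<lambda>x. x)"
    using tA by (simp add: continuous_map_in_subtopology)
  have "continuous_map ?B (product_topology ?E {1..N}) (\<lambda>x. x)"
  proof (subst continuous_map_componentwise, intro conjI ballI)
    show "(\<lambda>x. x) ` topspace ?B \<subseteq> extensional {1..N}"
      by (auto simp: profiles_def PiE_iff)
    fix i assume i: "i \<in> {1..N}"
    have "continuous_on (profiles N X) (\<lambda>x. x i)"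
      by (rule continuous_on_product_then_coordinatewise[OF continuous_on_id])
    moreover have "(\<lambda>x. x i) ` profiles N X \<subseteq> topspace (?E i)"
      using assms i unfolding profiles_def PiE_iff decision_sets_def by blast
    ultimately show "continuous_map ?B (?E i) (\<lambda>x. x i)"
      by (subst tE) (auto simp: continuous_map_in_subtopology)
  qed
  then have BA: "continuous_map ?B ?A (\<lambda>x. x)"
    by (simp add: continuous_map_in_subtopology)
  have "homeomorphic_map ?A ?B id"
    using AB BA unfolding homeomorphic_map_maps homeomorphic_maps_def id_def by auto
  then show ?thesis by simp
qed

definition SOL :: "(profile \<Rightarrow> 'p \<Rightarrow> real) \<Rightarrow> (profile \<Rightarrow> 'p set) \<Rightarrow> profile \<Rightarrow> 'p set" where
  "SOL f M x = {p \<in> M x. \<forall>q\<in>M x. f x p \<le> f x q}"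

definition Omega :: "(nat \<Rightarrow> strategy set) \<Rightarrow> (profile \<Rightarrow> 'p \<Rightarrow> real) \<Rightarrow> (profile \<Rightarrow> 'p set)
    \<Rightarrow> nat \<Rightarrow> profile \<Rightarrow> (strategy \<times> 'p) set" where
  "Omega X f M i y = {(xi, p'). xi \<in> X i \<and> p' \<in> SOL f M (y(i := xi))}"

definition F1 :: "nat \<Rightarrow> (nat \<Rightarrow> strategy set) \<Rightarrow> (profile \<Rightarrow> 'p \<Rightarrow> real) \<Rightarrow> (profile \<Rightarrow> 'p set)
    \<Rightarrow> (profile \<times> 'p) set" where
  "F1 N X f M = {(x, p). x \<in> profiles N X \<and> p \<in> SOL f M x}"

definition equilibrium :: "nat \<Rightarrow> (nat \<Rightarrow> strategy set) \<Rightarrow> (profile \<Rightarrow> 'p \<Rightarrow> real) \<Rightarrow> (profile \<Rightarrow> 'p set)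
    \<Rightarrow> ('p \<Rightarrow> profile \<Rightarrow> real) \<Rightarrow> (nat \<Rightarrow> profile \<Rightarrow> real) \<Rightarrow> profile \<Rightarrow> 'p \<Rightarrow> bool" where
  "equilibrium N X f M h g x p \<longleftrightarrow> (x, p) \<in> F1 N X f M \<and>
     (\<forall>i\<in>{1..N}. \<forall>(xi, p') \<in> Omega X f M i (rivals N i x).
        h p x + g i x \<ge> h p' ((rivals N i x)(i := xi)) + g i ((rivals N i x)(i := xi)))"

definition potential_function :: "nat \<Rightarrow> (nat \<Rightarrow> strategy set) \<Rightarrow> (nat \<Rightarrow> profile \<Rightarrow> real)
    \<Rightarrow> (profile \<Rightarrow> real) \<Rightarrow> bool" where
  "potential_function N X g \<pi> \<longleftrightarrow>
     (\<forall>i\<in>{1..N}. \<forall>y\<in>rival_profiles N X i. \<forall>a\<in>X i. \<forall>b\<in>X i.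
        g i (y(i := a)) - g i (y(i := b)) = \<pi> (y(i := a)) - \<pi> (y(i := b)))"

text \<open>Set-valued maps on \<open>S\<close>, with Hogan's sequential notions of closedness and openness.\<close>

definition closed_map_at :: "'a::topological_space set \<Rightarrow> ('a \<Rightarrow> 'b::topological_space set) \<Rightarrow> 'a \<Rightarrow> bool" where
  "closed_map_at S M x \<longleftrightarrow>
     (\<forall>xs ps p. (\<forall>n. xs n \<in> S) \<and> xs \<longlonglongrightarrow> x \<and> (\<forall>n. ps n \<in> M (xs n)) \<and> ps \<longlonglongrightarrow> p \<longrightarrow> p \<in> M x)"

definition open_map_at :: "'a::topological_space set \<Rightarrow> ('a \<Rightarrow> 'b::topological_space set) \<Rightarrow> 'a \<Rightarrow> bool" where
  "open_map_at S M x \<longleftrightarrow>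
     (\<forall>xs p. (\<forall>n. xs n \<in> S) \<and> xs \<longlonglongrightarrow> x \<and> p \<in> M x \<longrightarrow>
        (\<exists>m ps. ps \<longlonglongrightarrow> p \<and> (\<forall>n\<ge>m. ps n \<in> M (xs n))))"

definition continuous_set_map :: "'a::topological_space set \<Rightarrow> ('a \<Rightarrow> 'b::topological_space set) \<Rightarrow> bool" where
  "continuous_set_map S M \<longleftrightarrow> (\<forall>x\<in>S. open_map_at S M x \<and> closed_map_at S M x)"

definition uniformly_bounded_set_map :: "'a set \<Rightarrow> ('a \<Rightarrow> 'b::metric_space set) \<Rightarrow> bool" where
  "uniformly_bounded_set_map S M \<longleftrightarrow> bounded (\<Union>x\<in>S. M x)"

end

theory Submission
  imports Defs
begin

text \<open>
  Existence: all players share the term \<open>h\<close>, so a unilateral move of player \<open>i\<close> changes the payoff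
  \<open>h p x + g i x\<close> by exactly as much as it changes \<open>h p x + \<pi> x\<close>. Moreover, a deviation in
  \<open>Omega\<close> again yields a point of \<open>F1\<close>, because each player anticipates the price: the whole game is
  a search for improvements of one function over one set. A global maximizer of \<open>h p x + \<pi> x\<close> over
  \<open>F1\<close> therefore leaves no profitable deviation (\<open>potential_maximizer_equilibrium\<close>), and
  compactness provides a maximizer.

  Compactness: \<open>F1\<close> is the graph of the minimizer map of a parametric optimization problem. It lies
  in the compact product of the profile set and the closure of the union of all \<open>M x\<close>, so it is
  enough that it is closed (\<open>closed_minimizer_graph\<close>). Closedness of \<open>M\<close> keeps a limit of
  minimizers feasible. Openness of \<open>M\<close> keeps it optimal: every competitor in the limit problem
  is a limit of competitors in the approximating problems, and the inequalities between the
  objective values pass to the limit.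
\<close>

lemma potential_maximizer_equilibrium:
  assumes pot: "potential_function N X g \<pi>"
    and F: "(x, p) \<in> F1 N X f M"
    and max: "\<And>x' p'. (x', p') \<in> F1 N X f M \<Longrightarrow> h p' x' + \<pi> x' \<le> h p x + \<pi> x"
  shows "equilibrium N X f M h g x p"
  unfolding equilibrium_def
proof (intro conjI ballI F, clarify)
  fix i xi p'
  assume i: "i \<in> {1..N}" and dev: "(xi, p') \<in> Omega X f M i (rivals N i x)"
  let ?y = "rivals N i x"
  have x: "x \<in> profiles N X" using F by (simp add: F1_def)
  then have y: "?y \<in> rival_profiles N X i" by (rule rivals_in_rival_profiles)
  have xi: "xi \<in> X i" "p' \<in> SOL f M (?y(i := xi))"
    using dev by (auto simp: Omega_def)
  then have "(?y(i := xi), p') \<in> F1 N X f M"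
    using join_in_profiles[OF i y] by (simp add: F1_def)
  from max[OF this] have "h p' (?y(i := xi)) + \<pi> (?y(i := xi)) \<le> h p x + \<pi> x" .
  moreover have "x i \<in> X i" using x i by (auto simp: profiles_def)
  then have "g i (?y(i := x i)) - g i (?y(i := xi)) = \<pi> (?y(i := x i)) - \<pi> (?y(i := xi))"
    using pot i y xi unfolding potential_function_def by blast
  then have "g i x - g i (?y(i := xi)) = \<pi> x - \<pi> (?y(i := xi))"
    by (simp only: join_rivals[OF i x])
  ultimately show "h p' (?y(i := xi)) + g i (?y(i := xi)) \<le> h p x + g i x"
    by linarith
qed

text \<open>
  This is the part of Berge's maximum theorem that concerns the argmin map. The two halves of the
  continuity of \<open>M\<close> are used separately: closedness for the feasibility of the limit, openness for
  its optimality.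
\<close>

lemma closed_minimizer_graph:
  fixes S :: "'a::first_countable_topology set"
    and M :: "'a \<Rightarrow> 'b::first_countable_topology set"
    and f :: "'a \<Rightarrow> 'b \<Rightarrow> real"
  assumes S: "closed S"
    and f: "continuous_on (S \<times> UNIV) (\<lambda>(x, p). f x p)"
    and M: "continuous_set_map S M"
  shows "closed {(x, p). x \<in> S \<and> p \<in> M x \<and> (\<forall>q\<in>M x. f x p \<le> f x q)}"
    (is "closed ?G")
proof (subst closed_sequential_limits, intro allI impI, elim conjE)
  fix z :: "nat \<Rightarrow> 'a \<times> 'b" and l
  assume z: "\<forall>n. z n \<in> ?G" and lim: "z \<longlonglongrightarrow> l"
  obtain x p where l: "l = (x, p)" by (cases l)
  define xs where "xs = (\<lambda>n. fst (z n))"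
  define ps where "ps = (\<lambda>n. snd (z n))"
  have xs: "xs n \<in> S" and ps: "ps n \<in> M (xs n)"
    and min: "\<And>q. q \<in> M (xs n) \<Longrightarrow> f (xs n) (ps n) \<le> f (xs n) q" for n
    using z[rule_format, of n] by (auto simp: xs_def ps_def case_prod_beta)
  have xl: "xs \<longlonglongrightarrow> x" and pl: "ps \<longlonglongrightarrow> p"
    using tendsto_fst[OF lim] tendsto_snd[OF lim] by (simp_all add: xs_def ps_def l)
  have x: "x \<in> S" using S xs xl by (rule closed_sequentially)
  have f_lim: "(\<lambda>n. f (xs n) (qs n)) \<longlonglongrightarrow> f x q" if "qs \<longlonglongrightarrow> q" for qs q
    using continuous_on_tendsto_compose[OF f tendsto_Pair[OF xl that]] x xs by simp
  have "p \<in> M x"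
    using M x xs xl ps pl unfolding continuous_set_map_def closed_map_at_def by blast
  moreover have "f x p \<le> f x q" if q: "q \<in> M x" for q
  proof -
    obtain m qs where ql: "qs \<longlonglongrightarrow> q" and qs: "\<forall>n\<ge>m. qs n \<in> M (xs n)"
      using M x xs xl q unfolding continuous_set_map_def open_map_at_def by blast
    show ?thesis
      using f_lim[OF pl] f_lim[OF ql] by (rule LIMSEQ_le) (use min qs in blast)
  qed
  ultimately show "l \<in> ?G" using x l by simp
qed

lemma compact_F1:
  fixes M :: "profile \<Rightarrow> 'p::heine_borel set"
  assumes X: "compact (profiles N X)"
    and f: "continuous_on (profiles N X \<times> UNIV) (\<lambda>(x, p). f x p)"
    and M: "continuous_set_map (profiles N X) M"
    and bdd: "uniformly_bounded_set_map (profiles N X) M"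
  shows "compact (F1 N X f M)"
proof -
  let ?K = "profiles N X \<times> closure (\<Union>x\<in>profiles N X. M x)"
  have "compact ?K"
    using X bdd by (intro compact_Times) (simp_all add: uniformly_bounded_set_map_def)
  moreover have "closed (F1 N X f M)"
    using closed_minimizer_graph[OF compact_imp_closed[OF X] f M] by (simp add: F1_def SOL_def)
  moreover have "F1 N X f M \<subseteq> ?K"
    using closure_subset by (fastforce simp: F1_def SOL_def)
  ultimately show ?thesis
    by (metis compact_Int_closed inf.absorb_iff2)
qed

theorem mainTheorem2:
  fixes N :: nat
    and m :: "nat \<Rightarrow> nat"
    and X :: "nat \<Rightarrow> strategy set"
    and h :: "real ^ 'k \<Rightarrow> profile \<Rightarrow> real"
    and g :: "nat \<Rightarrow> profile \<Rightarrow> real"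
    and f :: "profile \<Rightarrow> real ^ 'k \<Rightarrow> real"
    and M :: "profile \<Rightarrow> (real ^ 'k) set"
    and \<pi> :: "profile \<Rightarrow> real"
  assumes "decision_sets N m X"
    and "potential_function N X g \<pi>"
  shows "(continuous_on (profiles N X \<times> UNIV) (\<lambda>(x, p). h p x + \<pi> x) \<and>
            F1 N X f M \<noteq> {} \<and> compact (F1 N X f M)
          \<longrightarrow> (\<exists>x p. equilibrium N X f M h g x p)) \<and>
         (compact (profiles N X) \<and>
            continuous_on (profiles N X \<times> UNIV) (\<lambda>(x, p). f x p) \<and>
            continuous_set_map (profiles N X) M \<and>
            uniformly_bounded_set_map (profiles N X) M
          \<longrightarrow> compact (F1 N X f M))"
proof (intro conjI impI; elim conjE)
  assume cont: "continuous_on (profiles N X \<times> UNIV) (\<lambda>(x, p). h p x + \<pi> x)"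
    and "F1 N X f M \<noteq> {}" "compact (F1 N X f M)"
  moreover have "continuous_on (F1 N X f M) (\<lambda>(x, p). h p x + \<pi> x)"
    using cont by (rule continuous_on_subset) (auto simp: F1_def)
  ultimately obtain x p where "(x, p) \<in> F1 N X f M"
    and "\<And>x' p'. (x', p') \<in> F1 N X f M \<Longrightarrow> h p' x' + \<pi> x' \<le> h p x + \<pi> x"
    using continuous_attains_sup[of "F1 N X f M" "\<lambda>(x, p). h p x + \<pi> x"] by fast
  with assms(2) show "\<exists>x p. equilibrium N X f M h g x p"
    by (blast intro: potential_maximizer_equilibrium)
qed (rule compact_F1)

end
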